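(* Let $k\ge3$ and $e\ge2$ be integers. Then for every integer $n$ with $$\Bigl\lfloor \tfrac{k-1}{k}\cdot 2^e\Bigr\rfloor\le n\le 2^e-1,$$ we have $\mathrm{zcl}_k(P^n)=(k-1)(2^e-1)$.
   Context: $P^n$ denotes $n$-dimensional real projective space. $\mathrm{zcl}_k(P^n)$ is the lower bound for the higher topological complexity $\mathrm{TC}_k(P^n)$ implied by mod-2 cohomology (the $k$-th zero-divisor cup length). Explicitly, write $H^*((P^n)^k;\mathbb{Z}/2)=\mathbb{Z}/2[x_1,\ldots,x_k]/(x_1^{n+1},\ldots,x_k^{n+1})$ with each $x_i$ of degree $1$. Then $\mathrm{zcl}_k(P^n)$ is the largest integer $N$ for which there are nonnegative integers $a_1,\ldots,a_{k-1}$ with $a_1+\cdots+a_{k-1}=N$ and $$(x_1+x_k)^{a_1}\cdots(x_{k-1}+x_k)^{a_{k-1}}\neq0$$ in this ring. (Equivalently, it is the largest number of elements of the kernel of the map $H^*((P^n)^k;\mathbb{Z}/2)\to H^*(P^n;\mathbb{Z}/2)$ induced by the diagonal whose product is nonzero.) *)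

theory Defs
  imports Complex_Main "HOL-Library.Poly_Mapping" "HOL-Library.Z2" "HOL-Algebra.QuotRing"
begin

type_synonym mod2_poly = "(nat \<Rightarrow>\<^sub>0 nat) \<Rightarrow>\<^sub>0 bit"

definition poly_var :: "nat \<Rightarrow> mod2_poly" where
  "poly_var i = Poly_Mapping.single (Poly_Mapping.single i 1) 1"

text \<open>The polynomial ring over \<open>\<int>/2\<close> in the variables \<open>x\<^sub>1, \<dots>, x\<^sub>k\<close>: among all polynomials in
  variables indexed by \<^typ>\<open>nat\<close>, those whose monomials involve only indices in \<open>{1..k}\<close>.\<close>

definition mod2_poly_ring :: "nat \<Rightarrow> mod2_poly ring" where
  "mod2_poly_ring k =
    \<lparr>carrier = {p. \<forall>m \<in> Poly_Mapping.keys p. Poly_Mapping.keys m \<subseteq> {1..k}},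
     mult = (*), one = 1, zero = 0, add = (+)\<rparr>"

definition trunc_ideal :: "nat \<Rightarrow> nat \<Rightarrow> mod2_poly set" where
  "trunc_ideal k n = Idl\<^bsub>mod2_poly_ring k\<^esub> ((\<lambda>i. poly_var i ^ (n + 1)) ` {1..k})"

text \<open>The mod-2 cohomology ring of the \<open>k\<close>-fold product of \<open>P\<^sup>n\<close>, given by its presentation
  \<open>\<int>/2[x\<^sub>1, \<dots>, x\<^sub>k] / (x\<^sub>1\<^bsup>n+1\<^esup>, \<dots>, x\<^sub>k\<^bsup>n+1\<^esup>)\<close>; its elements are cosets.\<close>

definition coh_ring :: "nat \<Rightarrow> nat \<Rightarrow> mod2_poly set ring" where
  "coh_ring k n = mod2_poly_ring k Quot trunc_ideal k n"

definition coh_gen :: "nat \<Rightarrow> nat \<Rightarrow> nat \<Rightarrow> mod2_poly set" where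
  "coh_gen k n i = trunc_ideal k n +>\<^bsub>mod2_poly_ring k\<^esub> poly_var i"

definition zero_divisor_product :: "nat \<Rightarrow> nat \<Rightarrow> (nat \<Rightarrow> nat) \<Rightarrow> mod2_poly set" where
  "zero_divisor_product k n a =
    (\<Otimes>\<^bsub>coh_ring k n\<^esub>i \<in> {1..<k}.
      (coh_gen k n i \<oplus>\<^bsub>coh_ring k n\<^esub> coh_gen k n k) [^]\<^bsub>coh_ring k n\<^esub> a i)"

text \<open>The \<open>k\<close>-th zero-divisor cup length of \<open>P\<^sup>n\<close>. The maximum exists for \<open>k \<ge> 1\<close>: the empty product
  is nonzero, and a nonzero product has degree at most \<open>k n\<close>.\<close>

definition zcl :: "nat \<Rightarrow> nat \<Rightarrow> nat" where
  "zcl k n = (GREATEST N. \<exists>a. (\<Sum>i \<in> {1..<k}. a i) = N \<and>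
                 zero_divisor_product k n a \<noteq> \<zero>\<^bsub>coh_ring k n\<^esub>)"

lemma poly_var_closed: "i \<in> {1..k} \<Longrightarrow> poly_var i \<in> carrier (mod2_poly_ring k)"
  by (simp add: poly_var_def mod2_poly_ring_def)

lemma mod2_poly_ring_mult_closed:
  assumes "p \<in> carrier (mod2_poly_ring k)" "q \<in> carrier (mod2_poly_ring k)"
  shows "p * q \<in> carrier (mod2_poly_ring k)"
proof -
  have "Poly_Mapping.keys m \<subseteq> {1..k}" if m: "m \<in> Poly_Mapping.keys (p * q)" for m
  proof -
    obtain a b where ab: "m = a + b" "a \<in> Poly_Mapping.keys p" "b \<in> Poly_Mapping.keys q"
      using keys_mult[of p q] m by auto
    then show ?thesis
      using assms Poly_Mapping.keys_add[of a b] unfolding mod2_poly_ring_def by fastforce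
  qed
  then show ?thesis by (simp add: mod2_poly_ring_def)
qed

lemma mod2_poly_ring_cring: "cring (mod2_poly_ring k)"
proof (rule cringI)
  show "abelian_group (mod2_poly_ring k)"
  proof (rule abelian_groupI)
    show "x \<oplus>\<^bsub>mod2_poly_ring k\<^esub> y \<in> carrier (mod2_poly_ring k)"
      if "x \<in> carrier (mod2_poly_ring k)" "y \<in> carrier (mod2_poly_ring k)" for x y
      using that Poly_Mapping.keys_add[of x y] unfolding mod2_poly_ring_def by fastforce
    show "\<exists>y \<in> carrier (mod2_poly_ring k). y \<oplus>\<^bsub>mod2_poly_ring k\<^esub> x = \<zero>\<^bsub>mod2_poly_ring k\<^esub>"
      if "x \<in> carrier (mod2_poly_ring k)" for x
      using that by (intro bexI[of _ "- x"]) (auto simp: mod2_poly_ring_def)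
  qed (auto simp: mod2_poly_ring_def algebra_simps)
  show "Group.comm_monoid (mod2_poly_ring k)"
  proof (rule comm_monoidI)
    show "x \<otimes>\<^bsub>mod2_poly_ring k\<^esub> y \<in> carrier (mod2_poly_ring k)"
      if "x \<in> carrier (mod2_poly_ring k)" "y \<in> carrier (mod2_poly_ring k)" for x y
      using mod2_poly_ring_mult_closed[OF that] by (simp add: mod2_poly_ring_def)
  qed (auto simp: mod2_poly_ring_def algebra_simps)
qed (auto simp: mod2_poly_ring_def algebra_simps)

lemma poly_var_power_closed: "i \<in> {1..k} \<Longrightarrow> poly_var i ^ m \<in> carrier (mod2_poly_ring k)"
proof (induction m)
  case 0
  then show ?case by (simp add: mod2_poly_ring_def)
next
  case (Suc m)
  then show ?case by (simp add: mod2_poly_ring_mult_closed poly_var_closed)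
qed

lemma trunc_ideal_ideal: "ideal (trunc_ideal k n) (mod2_poly_ring k)"
proof -
  interpret cring "mod2_poly_ring k" by (rule mod2_poly_ring_cring)
  show ?thesis
    unfolding trunc_ideal_def by (rule genideal_ideal) (auto intro: poly_var_power_closed simp del: power_Suc)
qed

lemma coh_ring_cring: "cring (coh_ring k n)"
  unfolding coh_ring_def
  by (rule ideal.quotient_is_cring[OF trunc_ideal_ideal mod2_poly_ring_cring])

end

theory Submission
  imports Defs
begin

text \<open>In characteristic 2, \<open>(x + y)\<^bsup>2^e\<^esup> = x\<^bsup>2^e\<^esup> + y\<^bsup>2^e\<^esup>\<close>, which vanishes in the cohomology ring since
  \<open>n < 2^e\<close>; so every exponent of a nonzero product is at most \<open>2^e - 1\<close>. Conversely
  \<open>(x + y)\<^bsup>2^e-1\<^esup>\<close> is the sum of all monomials of degree \<open>2^e - 1\<close>, so the product with all exponents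
  \<open>2^e - 1\<close> contains \<open>x\<^sub>1\<^sup>n \<cdots> x\<^sub>k\<^sub>-\<^sub>1\<^sup>n x\<^sub>k\<^sup>r\<close> with \<open>r = (k-1)(2^e - 1 - n)\<close>, and the lower bound
  on \<open>n\<close> says exactly that \<open>r \<le> n\<close>.\<close>

section \<open>Powers of a sum in characteristic 2\<close>

lemma char2_add_power_two_power:
  fixes x y :: "'a::comm_ring_1"
  assumes "(2::'a) = 0"
  shows "(x + y) ^ (2 ^ e) = x ^ (2 ^ e) + y ^ (2 ^ e)"
proof (induction e)
  case (Suc e)
  have "(x + y) ^ (2 ^ Suc e) = ((x + y) ^ (2 ^ e))\<^sup>2"
    by (metis power_Suc2 power_mult)
  also have "\<dots> = (x ^ (2 ^ e))\<^sup>2 + (y ^ (2 ^ e))\<^sup>2"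
    by (simp add: Suc power2_sum assms)
  also have "\<dots> = x ^ (2 ^ Suc e) + y ^ (2 ^ Suc e)"
    by (metis power_Suc2 power_mult)
  finally show ?case .
qed simp

text \<open>With \<open>q = 2 ^ e\<close>, doubling rests on (x+y)^(2q-1) = (x+y)^(q-1) (x^q + y^q).
  The summands with \<open>j < q\<close> are those of the previous sum times y^q, and the others,
  reindexed by \<open>j + q\<close>, are those times x^q. Equivalently, all binomial coefficients of
  2^e - 1 are odd.\<close>

lemma char2_add_power_two_power_minus_one:
  fixes x y :: "'a::comm_ring_1"
  assumes "(2::'a) = 0"
  shows "(x + y) ^ (2 ^ e - 1) = (\<Sum>j<2 ^ e. x ^ j * y ^ (2 ^ e - 1 - j))"
proof (induction e)
  case (Suc e)
  let ?q = "2 ^ e :: nat"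
  let ?f = "\<lambda>j. x ^ j * y ^ (2 * ?q - 1 - j)"
  have "{..<2 * ?q} = {..<?q} \<union> {?q..<?q + ?q}"
    by auto
  then have "(\<Sum>j<2 * ?q. ?f j) = (\<Sum>j<?q. ?f j) + (\<Sum>j=?q..<?q + ?q. ?f j)"
    by (simp add: sum.union_disjoint ivl_disj_int)
  also have "(\<Sum>j=?q..<?q + ?q. ?f j) = (\<Sum>j<?q. ?f (j + ?q))"
    using sum.shift_bounds_nat_ivl[of ?f 0 ?q ?q] by (simp add: atLeast0LessThan)
  also have "\<dots> = (\<Sum>j<?q. x ^ j * y ^ (?q - 1 - j)) * x ^ ?q"
    unfolding sum_distrib_right
  proof (rule sum.cong)
    fix j assume "j \<in> {..<?q}"
    have "2 * ?q - 1 - (j + ?q) = ?q - 1 - j"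
      by simp
    then show "?f (j + ?q) = x ^ j * y ^ (?q - 1 - j) * x ^ ?q"
      by (simp only: power_add) (simp add: mult_ac)
  qed simp
  also have "(\<Sum>j<?q. ?f j) = (\<Sum>j<?q. x ^ j * y ^ (?q - 1 - j)) * y ^ ?q"
    unfolding sum_distrib_right
  proof (rule sum.cong)
    fix j assume "j \<in> {..<?q}"
    then have "2 * ?q - 1 - j = (?q - 1 - j) + ?q"
      by auto
    then show "?f j = x ^ j * y ^ (?q - 1 - j) * y ^ ?q"
      by (simp only: power_add) (simp add: mult_ac)
  qed simp
  also have "(\<Sum>j<?q. x ^ j * y ^ (?q - 1 - j)) * y ^ ?q
      + (\<Sum>j<?q. x ^ j * y ^ (?q - 1 - j)) * x ^ ?q
    = (x + y) ^ (?q - 1) * (x + y) ^ ?q"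
    by (simp only: Suc.IH[symmetric] char2_add_power_two_power[OF assms]) (simp add: algebra_simps)
  also have "\<dots> = (x + y) ^ (2 * ?q - 1)"
  proof -
    have "?q - 1 + ?q = 2 * ?q - 1"
      by simp
    then show ?thesis
      by (simp only: power_add[symmetric])
  qed
  finally show ?case
    by simp
qed simp

section \<open>Arithmetic of polynomials over Z/2\<close>

lemma mod2_poly_two_eq_zero: "(2 :: mod2_poly) = 0"
proof -
  have "b + b = 0" for b :: bit
    by (metis bit_2_eq_0 mult_2 mult_zero_left)
  then have "(1 :: mod2_poly) + 1 = 0"
    by (intro poly_mapping_eqI) (simp only: lookup_add lookup_zero)
  then show ?thesis
    by simp
qed

lemma poly_var_power:
  "poly_var i ^ m = Poly_Mapping.single (Poly_Mapping.single i m) 1"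
  by (induction m) (simp_all add: poly_var_def mult_single single_add[symmetric] flip: single_one)

lemma prod_single_one:
  "finite S \<Longrightarrow> (\<Prod>i\<in>S. Poly_Mapping.single (f i) (1::bit)) = Poly_Mapping.single (\<Sum>i\<in>S. f i) 1"
  by (induction S rule: finite_induct) (simp_all add: mult_single)

lemma mod2_poly_ring_simps:
  "x \<otimes>\<^bsub>mod2_poly_ring k\<^esub> y = x * y" "x \<oplus>\<^bsub>mod2_poly_ring k\<^esub> y = x + y"
  "\<one>\<^bsub>mod2_poly_ring k\<^esub> = 1" "\<zero>\<^bsub>mod2_poly_ring k\<^esub> = 0"
  by (simp_all add: mod2_poly_ring_def)

lemma mod2_poly_ring_pow: "p [^]\<^bsub>mod2_poly_ring k\<^esub> (m::nat) = p ^ m"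
proof -
  interpret cring "mod2_poly_ring k" by (rule mod2_poly_ring_cring)
  show ?thesis
    by (induction m) (simp_all add: mod2_poly_ring_simps mult.commute)
qed

lemma mod2_poly_ring_finprod:
  assumes "finite S" "\<And>i. i \<in> S \<Longrightarrow> f i \<in> carrier (mod2_poly_ring k)"
  shows "(\<Otimes>\<^bsub>mod2_poly_ring k\<^esub>i\<in>S. f i) = (\<Prod>i\<in>S. f i)"
proof -
  interpret cring "mod2_poly_ring k" by (rule mod2_poly_ring_cring)
  show ?thesis
    using assms by (induction S rule: finite_induct) (auto simp: mod2_poly_ring_simps)
qed

lemma prod_in_mod2_poly_ring:
  assumes "finite S" "\<And>i. i \<in> S \<Longrightarrow> f i \<in> carrier (mod2_poly_ring k)"
  shows "(\<Prod>i\<in>S. f i) \<in> carrier (mod2_poly_ring k)"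
proof -
  interpret cring "mod2_poly_ring k" by (rule mod2_poly_ring_cring)
  show ?thesis
    using finprod_closed[of f S] assms by (auto simp: mod2_poly_ring_finprod)
qed

lemma poly_var_add_power_closed:
  assumes "i \<in> {1..k}" "j \<in> {1..k}"
  shows "(poly_var i + poly_var j) ^ m \<in> carrier (mod2_poly_ring k)"
proof -
  interpret cring "mod2_poly_ring k" by (rule mod2_poly_ring_cring)
  show ?thesis
    using nat_pow_closed[OF a_closed[OF poly_var_closed[OF assms(1)] poly_var_closed[OF assms(2)]]]
    by (simp add: mod2_poly_ring_simps mod2_poly_ring_pow)
qed

section \<open>From the quotient ring to ideal membership\<close>

text \<open>The projection to the quotient is a ring homomorphism, so it commutes with the sums,
  powers and product involved. Computations can then be done on an ordinary polynomial
  representative.\<close>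

lemma zero_divisor_product_eq_coset:
  "zero_divisor_product k n a =
    trunc_ideal k n +>\<^bsub>mod2_poly_ring k\<^esub> (\<Prod>i\<in>{1..<k}. (poly_var i + poly_var k) ^ a i)"
proof -
  let ?R = "mod2_poly_ring k"
  let ?h = "(+>\<^bsub>?R\<^esub>) (trunc_ideal k n)"
  interpret R: cring ?R by (rule mod2_poly_ring_cring)
  interpret Q: cring "coh_ring k n" by (rule coh_ring_cring)
  interpret h: ring_hom_cring ?R "coh_ring k n" ?h
    using ideal.rcos_ring_hom[OF trunc_ideal_ideal, of k n]
    by unfold_locales (simp add: coh_ring_def)
  have factor: "(coh_gen k n i \<oplus>\<^bsub>coh_ring k n\<^esub> coh_gen k n k) [^]\<^bsub>coh_ring k n\<^esub> a i
      = ?h ((poly_var i + poly_var k) ^ a i)"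
    and closed: "(poly_var i + poly_var k) ^ a i \<in> carrier ?R"
    if "i \<in> {1..<k}" for i
  proof -
    have ik: "i \<in> {1..k}" "k \<in> {1..k}"
      using that by auto
    note c = poly_var_closed[OF ik(1)] poly_var_closed[OF ik(2)]
    show "(coh_gen k n i \<oplus>\<^bsub>coh_ring k n\<^esub> coh_gen k n k) [^]\<^bsub>coh_ring k n\<^esub> a i
      = ?h ((poly_var i + poly_var k) ^ a i)"
      using ring_hom_ring.hom_nat_pow[OF ideal.rcos_ring_hom_ring[OF trunc_ideal_ideal] R.a_closed[OF c],
          of n "a i"] h.hom_add[OF c]
      by (simp add: coh_gen_def coh_ring_def mod2_poly_ring_pow mod2_poly_ring_simps)
    show "(poly_var i + poly_var k) ^ a i \<in> carrier ?R"
      by (rule poly_var_add_power_closed[OF ik])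
  qed
  have "zero_divisor_product k n a =
      (\<Otimes>\<^bsub>coh_ring k n\<^esub>i\<in>{1..<k}. ?h ((poly_var i + poly_var k) ^ a i))"
    unfolding zero_divisor_product_def
    using closed by (intro Q.finprod_cong') (auto simp: factor simp del: One_nat_def)
  also have "\<dots> = ?h (\<Otimes>\<^bsub>?R\<^esub>i\<in>{1..<k}. (poly_var i + poly_var k) ^ a i)"
    using closed by (subst h.hom_finprod) (auto simp: comp_def)
  also have "(\<Otimes>\<^bsub>?R\<^esub>i\<in>{1..<k}. (poly_var i + poly_var k) ^ a i)
      = (\<Prod>i\<in>{1..<k}. (poly_var i + poly_var k) ^ a i)"
    using closed by (intro mod2_poly_ring_finprod) auto
  finally show ?thesis .
qed

lemma zero_divisor_product_eq_zero_iff: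
  "zero_divisor_product k n a = \<zero>\<^bsub>coh_ring k n\<^esub> \<longleftrightarrow>
    (\<Prod>i\<in>{1..<k}. (poly_var i + poly_var k) ^ a i) \<in> trunc_ideal k n"
proof -
  interpret I: ideal "trunc_ideal k n" "mod2_poly_ring k" by (rule trunc_ideal_ideal)
  have "(\<Prod>i\<in>{1..<k}. (poly_var i + poly_var k) ^ a i) \<in> carrier (mod2_poly_ring k)"
    by (rule prod_in_mod2_poly_ring) (auto intro!: poly_var_add_power_closed)
  then show ?thesis
    using I.a_rcos_zero[OF trunc_ideal_ideal] I.rcos_const_imp_mem
    by (auto simp: zero_divisor_product_eq_coset coh_ring_def FactRing_def)
qed

text \<open>The ideal lies in the monomial ideal of polynomials in which every monomial has some
  exponent above \<open>n\<close>. Hence a single nonzero coefficient at a monomial with all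
  exponents at most \<open>n\<close> certifies non-membership.\<close>

lemma trunc_ideal_lookup_eq_zero:
  assumes "p \<in> trunc_ideal k n" and "\<And>i. Poly_Mapping.lookup m i \<le> n"
  shows "Poly_Mapping.lookup p m = 0"
proof -
  let ?R = "mod2_poly_ring k"
  interpret R: cring ?R by (rule mod2_poly_ring_cring)
  define J where "J = {p \<in> carrier ?R. \<forall>m. (\<forall>i. Poly_Mapping.lookup m i \<le> n) \<longrightarrow> m \<notin> Poly_Mapping.keys p}"
  have mult_J: "q * p \<in> J" if "p \<in> J" "q \<in> carrier ?R" for p q
  proof -
    have "m \<notin> Poly_Mapping.keys (q * p)" if m: "\<forall>i. Poly_Mapping.lookup m i \<le> n" for m
    proof
      assume "m \<in> Poly_Mapping.keys (q * p)"
      then obtain a b where ab: "m = a + b" "b \<in> Poly_Mapping.keys p"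
        using keys_mult[of q p] by auto
      \<comment> \<open>The monomial \<open>b\<close> divides \<open>m\<close>, so it inherits the
        bound on the exponents, and no such monomial occurs in \<open>p\<close>.\<close>
      have "\<forall>i. Poly_Mapping.lookup b i \<le> n"
        using m unfolding ab(1) by (auto simp: lookup_add intro: add_leD2)
      then show False
        using ab(2) \<open>p \<in> J\<close> by (auto simp: J_def)
    qed
    then show ?thesis
      using that mod2_poly_ring_mult_closed[of q k p] by (auto simp: J_def)
  qed
  have "ideal J ?R"
  proof (rule idealI)
    show "ring ?R" by (rule R.ring_axioms)
    show "subgroup J (add_monoid ?R)"
    proof (rule R.add.subgroupI)
      show "J \<subseteq> carrier ?R" by (auto simp: J_def)
      have "0 \<in> J" by (simp add: J_def mod2_poly_ring_def)
      then show "J \<noteq> {}" by auto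
      show "\<ominus>\<^bsub>?R\<^esub> p \<in> J" if "p \<in> J" for p
      proof -
        have p: "p \<in> carrier ?R" using that by (simp add: J_def)
        \<comment> \<open>In characteristic 2 every polynomial is its own negative.\<close>
        have "p + p = 2 * p" by simp
        then have "p \<oplus>\<^bsub>?R\<^esub> p = \<zero>\<^bsub>?R\<^esub>"
          by (simp add: mod2_poly_ring_simps mod2_poly_two_eq_zero del: mult_2)
        then have "\<ominus>\<^bsub>?R\<^esub> p = p"
          using p by (simp add: R.minus_equality)
        then show ?thesis using that by simp
      qed
      show "p \<oplus>\<^bsub>?R\<^esub> q \<in> J" if "p \<in> J" "q \<in> J" for p q
        using that R.a_closed[of p q] Poly_Mapping.keys_add[of p q]
        by (fastforce simp: J_def mod2_poly_ring_simps)
    qed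
  next
    fix p q assume "p \<in> J" "q \<in> carrier ?R"
    then have "q * p \<in> J" by (rule mult_J)
    then show "q \<otimes>\<^bsub>?R\<^esub> p \<in> J" "p \<otimes>\<^bsub>?R\<^esub> q \<in> J"
      by (simp_all add: mod2_poly_ring_simps mult.commute)
  qed
  moreover have "(\<lambda>i. poly_var i ^ (n + 1)) ` {1..k} \<subseteq> J"
  proof safe
    fix i assume i: "i \<in> {1..k}"
    have "n < Poly_Mapping.lookup (Poly_Mapping.single i (n + 1)) i"
      by simp
    then show "poly_var i ^ (n + 1) \<in> J"
      unfolding J_def using poly_var_power_closed[OF i, of "n + 1"]
      by (auto simp: poly_var_power leD simp del: power_Suc lookup_single_eq)
  qed
  ultimately have "trunc_ideal k n \<subseteq> J"
    unfolding trunc_ideal_def by (rule R.genideal_minimal)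
  then have "m \<notin> Poly_Mapping.keys p"
    using assms by (auto simp: J_def)
  then show ?thesis
    by (simp add: in_keys_iff)
qed

lemma poly_var_power_in_trunc_ideal:
  assumes "i \<in> {1..k}" "n < m"
  shows "poly_var i ^ m \<in> trunc_ideal k n"
proof -
  let ?R = "mod2_poly_ring k"
  interpret R: cring ?R by (rule mod2_poly_ring_cring)
  interpret I: ideal "trunc_ideal k n" ?R by (rule trunc_ideal_ideal)
  have "(\<lambda>i. poly_var i ^ (n + 1)) ` {1..k} \<subseteq> trunc_ideal k n"
    unfolding trunc_ideal_def
    by (rule R.genideal_self) (auto intro: poly_var_power_closed simp del: power_Suc)
  then have "poly_var i ^ (n + 1) \<in> trunc_ideal k n"
    using assms by blast
  from I.I_l_closed[OF this poly_var_power_closed[OF assms(1), of "m - (n + 1)"]]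
  show ?thesis
    using assms(2) by (simp add: mod2_poly_ring_simps flip: power_add power_Suc)
qed

section \<open>Vanishing and non-vanishing products\<close>

lemma zero_divisor_product_eq_zero:
  assumes "i \<in> {1..<k}" "n < 2 ^ e" "2 ^ e \<le> a i"
  shows "zero_divisor_product k n a = \<zero>\<^bsub>coh_ring k n\<^esub>"
proof -
  let ?R = "mod2_poly_ring k"
  interpret I: ideal "trunc_ideal k n" ?R by (rule trunc_ideal_ideal)
  have ik: "i \<in> {1..k}" "k \<in> {1..k}"
    using assms(1) by auto
  have "(poly_var i + poly_var k) ^ (2 ^ e) \<in> trunc_ideal k n"
    using additive_subgroup.a_closed[OF I.additive_subgroup_axioms poly_var_power_in_trunc_ideal[OF ik(1) assms(2)]
        poly_var_power_in_trunc_ideal[OF ik(2) assms(2)]]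
    by (simp add: mod2_poly_ring_simps char2_add_power_two_power[OF mod2_poly_two_eq_zero])
  from I.I_r_closed[OF this poly_var_add_power_closed[OF ik, of "a i - 2 ^ e"]]
  have "(poly_var i + poly_var k) ^ a i \<in> trunc_ideal k n"
    using assms(3) by (simp add: mod2_poly_ring_simps flip: power_add)
  moreover have "(\<Prod>j\<in>{1..<k} - {i}. (poly_var j + poly_var k) ^ a j) \<in> carrier ?R"
    by (rule prod_in_mod2_poly_ring) (auto intro!: poly_var_add_power_closed)
  ultimately have "(poly_var i + poly_var k) ^ a i *
      (\<Prod>j\<in>{1..<k} - {i}. (poly_var j + poly_var k) ^ a j) \<in> trunc_ideal k n"
    using I.I_r_closed by (simp add: mod2_poly_ring_simps)
  then show ?thesis
    using assms(1) by (simp add: zero_divisor_product_eq_zero_iff prod.remove[of _ i])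
qed

text \<open>Distributing the product over the sums: a choice function \<open>j\<close> takes the
  monomial x_i^(j i) x_k^(2^e-1-j i) from the \<open>i\<close>-th factor. Extensionality in
  \<open>PiE\<close> makes each choice occur exactly once.\<close>

lemma prod_poly_var_add_power_two_power_minus_one:
  "(\<Prod>i\<in>{1..<k}. (poly_var i + poly_var k) ^ (2 ^ e - 1)) =
    (\<Sum>j\<in>PiE {1..<k} (\<lambda>_. {..<2 ^ e}). Poly_Mapping.single
      (\<Sum>i\<in>{1..<k}. Poly_Mapping.single i (j i) + Poly_Mapping.single k (2 ^ e - 1 - j i)) 1)"
  by (simp add: char2_add_power_two_power_minus_one[OF mod2_poly_two_eq_zero] prod_sum_PiE
      poly_var_power mult_single prod_single_one del: One_nat_def)

text \<open>For i < k the exponent of x_i in the monomial chosen by \<open>j\<close> is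
  \<open>j i\<close>, so different choices give different monomials. Nothing cancels mod 2, and it
  suffices to find one monomial with all exponents at most \<open>n\<close>.\<close>

lemma zero_divisor_product_neq_zero:
  assumes "n < 2 ^ e" "(k - 1) * (2 ^ e - 1 - n) \<le> n"
  shows "zero_divisor_product k n (\<lambda>_. 2 ^ e - 1) \<noteq> \<zero>\<^bsub>coh_ring k n\<^esub>"
proof -
  define mon where "mon j = (\<Sum>i\<in>{1..<k}.
      Poly_Mapping.single i (j i) + Poly_Mapping.single k (2 ^ e - 1 - j i))" for j :: "nat \<Rightarrow> nat"
  \<comment> \<open>Exponent \<open>n\<close> is the largest allowed on each x_i with i < k, so this
    choice leaves as little as possible for x_k. The restriction places \<open>c\<close> in the
    extensional \<open>PiE\<close>.\<close>
  define c where "c = restrict (\<lambda>_. n) {1..<k}"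
  have lookup_mon: "Poly_Mapping.lookup (mon j) i =
      (if i \<in> {1..<k} then j i else 0) + (if i = k then \<Sum>l\<in>{1..<k}. 2 ^ e - 1 - j l else 0)" for j i
    by (auto simp: mon_def lookup_sum lookup_add lookup_single when_def sum.distrib)
  have c: "c \<in> PiE {1..<k} (\<lambda>_. {..<2 ^ e})"
    using assms(1) by (auto simp: c_def)
  have mon_eq_iff: "mon j = mon c \<longleftrightarrow> j = c" if "j \<in> PiE {1..<k} (\<lambda>_. {..<2 ^ e})" for j
  proof
    assume eq: "mon j = mon c"
    show "j = c"
    proof (rule PiE_ext[OF that c])
      show "j i = c i" if "i \<in> {1..<k}" for i
        using lookup_mon[of j i] lookup_mon[of c i] that unfolding eq by simp
    qed
  qed simp
  have "Poly_Mapping.lookup (\<Prod>i\<in>{1..<k}. (poly_var i + poly_var k) ^ (2 ^ e - 1)) (mon c)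
      = (\<Sum>j\<in>PiE {1..<k} (\<lambda>_. {..<2 ^ e}). if j = c then 1 else 0)"
    unfolding prod_poly_var_add_power_two_power_minus_one lookup_sum mon_def[symmetric]
    by (intro sum.cong) (auto simp: lookup_single when_def mon_eq_iff)
  also have "\<dots> = 1"
    using c by (simp add: finite_PiE)
  finally have "Poly_Mapping.lookup (\<Prod>i\<in>{1..<k}. (poly_var i + poly_var k) ^ (2 ^ e - 1)) (mon c) \<noteq> 0"
    by simp
  \<comment> \<open>The only exponent needing an argument is that of x_k, namely (k-1)(2^e-1-n),
    bounded by the second assumption.\<close>
  moreover have "Poly_Mapping.lookup (mon c) i \<le> n" for i
    using assms(2) by (auto simp: lookup_mon c_def)
  ultimately show ?thesis
    using trunc_ideal_lookup_eq_zero unfolding zero_divisor_product_eq_zero_iff by blast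
qed

theorem theorem4p1:
  fixes k e n :: nat
  assumes "k \<ge> 3" and "e \<ge> 2"
    and "\<lfloor>(real k - 1) / real k * 2 ^ e\<rfloor> \<le> int n" and "n \<le> 2 ^ e - 1"
  shows "zcl k n = (k - 1) * (2 ^ e - 1)"
proof -
  define q :: nat where "q = 2 ^ e"
  have q: "q > 0" and n: "n < q"
    using assms(4) by (auto simp: q_def Suc_le_eq le_diff_conv2)
  \<comment> \<open>A floor is at most the integer \<open>n\<close> exactly when its argument is
    strictly below \<open>n + 1\<close>.\<close>
  have "(real k - 1) / real k * real q < real n + 1"
    using assms(3) by (simp add: floor_le_iff q_def)
  then have "real ((k - 1) * q) < real (k * (n + 1))"
    using assms(1) by (simp add: field_simps of_nat_diff)
  then have less: "(k - 1) * q < k * (n + 1)"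
    by (simp only: of_nat_less_iff)
  \<comment> \<open>Here \<open>s\<close> is q - 1 - n, free of truncated subtraction. The
    inequality \<open>less\<close> reads r(n+1+s) < (r+1)(n+1), that is, r s < n + 1.\<close>
  obtain r s where rs: "k = Suc r" "q = Suc (n + s)"
    using assms(1) n by (metis less_iff_Suc_add not0_implies_Suc not_numeral_le_zero)
  have "r * s \<le> n"
    using less by (simp add: rs algebra_simps)
  then have le: "(k - 1) * (2 ^ e - 1 - n) \<le> n"
    by (simp add: q_def[symmetric] rs)
  show ?thesis
    unfolding zcl_def
  proof (rule Greatest_equality)
    show "\<exists>a. (\<Sum>i\<in>{1..<k}. a i) = (k - 1) * (2 ^ e - 1) \<and>
        zero_divisor_product k n a \<noteq> \<zero>\<^bsub>coh_ring k n\<^esub>"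
      using zero_divisor_product_neq_zero[OF n[unfolded q_def] le]
      by (intro exI[of _ "\<lambda>_. 2 ^ e - 1"]) simp
  next
    fix N
    assume "\<exists>a. (\<Sum>i\<in>{1..<k}. a i) = N \<and> zero_divisor_product k n a \<noteq> \<zero>\<^bsub>coh_ring k n\<^esub>"
    then obtain a where a: "(\<Sum>i\<in>{1..<k}. a i) = N"
      "zero_divisor_product k n a \<noteq> \<zero>\<^bsub>coh_ring k n\<^esub>"
      by blast
    \<comment> \<open>A larger exponent would kill the product; summing this bound over the k - 1
      factors gives the upper bound.\<close>
    have "a i \<le> 2 ^ e - 1" if "i \<in> {1..<k}" for i
    proof (rule ccontr)
      assume "\<not> a i \<le> 2 ^ e - 1"
      then have "2 ^ e \<le> a i"
        by simp
      then show False
        using zero_divisor_product_eq_zero[OF that n[unfolded q_def]] a(2) by blast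
    qed
    then show "N \<le> (k - 1) * (2 ^ e - 1)"
      using sum_bounded_above[of "{1..<k}" a "2 ^ e - 1"] a(1) by simp
  qed
qed

end
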